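(* Let $A,B$ be positive definite complex $n\times n$ matrices, let $X$ be any complex $n\times n$ matrix, and let $0\leq t\leq 1$. If $(1-t)A^{-1}X+tXB^{-1}\neq 0$ and $(1-t)AX+tXB\neq 0$, then $$\|X\|_2^2\;\|(1-t)A^{-1}X+tXB^{-1}\|_2^{-1}\leq \|(1-t)AX+tXB\|_2.$$
   Context: $\|\cdot\|_2$ is the Hilbert–Schmidt (Frobenius) norm: $\|C\|_2=\left(\sum_{i,j}|c_{ij}|^2\right)^{1/2}$ for $C=[c_{ij}]$. *)

theory Defs
  imports "HOL-Analysis.Analysis"
begin

definition conj_transpose :: "complex ^ 'n ^ 'm \<Rightarrow> complex ^ 'm ^ 'n" where
  "conj_transpose A = (\<chi> i j. cnj (A $ j $ i))"

definition hermitian_form :: "complex ^ 'n ^ 'n \<Rightarrow> complex ^ 'n \<Rightarrow> complex" where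
  "hermitian_form A x = (\<Sum>i\<in>UNIV. cnj (x $ i) * (A *v x) $ i)"

text \<open>For a Hermitian matrix the form takes real values, so comparing its real part with 0 loses
  nothing.\<close>

definition positive_definite :: "complex ^ 'n ^ 'n \<Rightarrow> bool" where
  "positive_definite A \<longleftrightarrow>
     conj_transpose A = A \<and> (\<forall>x. x \<noteq> 0 \<longrightarrow> 0 < Re (hermitian_form A x))"

definition hs_norm :: "complex ^ 'n ^ 'm \<Rightarrow> real" where
  "hs_norm C = sqrt (\<Sum>i\<in>UNIV. \<Sum>j\<in>UNIV. (cmod (C $ i $ j))\<^sup>2)"

lemma hs_norm_eq_norm: "hs_norm C = norm C"
  by (simp add: hs_norm_def norm_vec_def L2_set_def sum_nonneg)

end

theory Submission
  imports Defs
begin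

text \<open>
  Left multiplication by \<open>A\<close> and right multiplication by \<open>B\<close> are commuting positive operators on the
  Hilbert space of matrices. In joint eigencoordinates with eigenvalues \<open>a\<close> and \<open>b\<close> the two averages
  in the theorem multiply a coordinate of \<open>X\<close> by \<open>(1 - t) a + t b\<close> and \<open>(1 - t) / a + t / b\<close>, and the
  product of these factors is at least 1, because \<open>a / b + b / a \<ge> 2\<close>.

  The proof below reaches the same conclusion without diagonalizing. Cauchy--Schwarz bounds the
  product of the two norms from below by the real inner product of the two averages. Expanding that
  inner product gives \<open>(1 - t)\<^sup>2 + t\<^sup>2\<close> copies of \<open>\<parallel>X\<parallel>\<^sup>2\<close>, together with the cross terms weighted by
  \<open>(1 - t) t\<close>; so it suffices that the cross terms add up to at least \<open>2 \<parallel>X\<parallel>\<^sup>2\<close>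
  (\<open>inner_cross_terms_ge\<close>). That is the operator form of \<open>a / b + b / a \<ge> 2\<close>, and it follows from the
  positivity of the single operator that sends \<open>Y\<close> to \<open>A Y B\<^sup>-\<^sup>1\<close>.

  Positivity of this operator (\<open>inner_two_sided_mult_nonneg\<close>) amounts to the fact that the trace of a
  product of two positive semidefinite matrices has nonnegative real part
  (\<open>trace_mult_positive_semidefinite_nonneg\<close>). Instead of square roots, its proof uses the elimination
  step of a Cholesky factorization: one of the matrices is split into a rank-one part and a Schur
  complement with fewer nonzero rows.
\<close>

section \<open>The Hermitian inner product and conjugate transposes\<close>

definition hdot :: "complex ^ 'n \<Rightarrow> complex ^ 'n \<Rightarrow> complex" where
  "hdot x y = (\<Sum>i\<in>UNIV. cnj (x $ i) * y $ i)"

lemma hermitian_form_eq_hdot: "hermitian_form A x = hdot x (A *v x)"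
  by (simp add: hermitian_form_def hdot_def)

lemma cnj_hdot: "cnj (hdot x y) = hdot y x"
  by (simp add: hdot_def mult.commute)

lemma hdot_add_left: "hdot (x + y) z = hdot x z + hdot y z"
  by (simp add: hdot_def distrib_right sum.distrib)

lemma hdot_add_right: "hdot x (y + z) = hdot x y + hdot x z"
  by (simp add: hdot_def distrib_left sum.distrib)

lemma hdot_cmult_left: "hdot (c *s x) y = cnj c * hdot x y"
  by (simp add: hdot_def sum_distrib_left mult.assoc)

lemma hdot_cmult_right: "hdot x (c *s y) = c * hdot x y"
  by (simp add: hdot_def sum_distrib_left mult.left_commute)

lemma hdot_axis_left: "hdot (axis k 1) x = x $ k"
proof -
  have "hdot (axis k 1) x = (\<Sum>i\<in>UNIV. if i = k then x $ i else 0)"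
    unfolding hdot_def axis_def by (intro sum.cong) auto
  then show ?thesis by simp
qed

lemma matrix_vector_mult_axis: "((M :: complex ^ 'n ^ 'n) *v axis k 1) $ i = M $ i $ k"
  by (simp add: matrix_vector_mult_def axis_def if_distrib cong: if_cong)

lemma hdot_conj_transpose_right: "hdot x (conj_transpose M *v y) = hdot (M *v x) y"
proof -
  have "hdot x (conj_transpose M *v y)
      = (\<Sum>i\<in>UNIV. \<Sum>j\<in>UNIV. cnj (x $ i) * (cnj (M $ j $ i) * y $ j))"
    by (simp add: hdot_def conj_transpose_def matrix_vector_mult_def sum_distrib_left)
  also have "\<dots> = (\<Sum>j\<in>UNIV. \<Sum>i\<in>UNIV. cnj (x $ i) * (cnj (M $ j $ i) * y $ j))"
    by (rule sum.swap)
  also have "\<dots> = hdot (M *v x) y"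
    by (simp add: hdot_def matrix_vector_mult_def sum_distrib_left sum_distrib_right mult_ac)
  finally show ?thesis .
qed

lemma matrix_mult_diff_distrib_left:
  fixes M Y Z :: "complex ^ 'n ^ 'n"
  shows "M ** (Y - Z) = M ** Y - M ** Z"
  by (simp add: vec_eq_iff matrix_matrix_mult_def right_diff_distrib sum_subtractf)

lemma matrix_mult_diff_distrib_right:
  fixes M Y Z :: "complex ^ 'n ^ 'n"
  shows "(Y - Z) ** M = Y ** M - Z ** M"
  by (simp add: vec_eq_iff matrix_matrix_mult_def left_diff_distrib sum_subtractf)

lemma conj_transpose_involution: "conj_transpose (conj_transpose M) = M"
  by (simp add: conj_transpose_def vec_eq_iff)

lemma conj_transpose_mult:
  "conj_transpose (M ** N) = conj_transpose N ** conj_transpose M"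
  by (simp add: conj_transpose_def vec_eq_iff matrix_matrix_mult_def mult.commute)

lemma conj_transpose_mat_1: "conj_transpose (mat 1) = mat 1"
  by (auto simp: conj_transpose_def vec_eq_iff mat_def)

lemma hermitian_entry:
  assumes "conj_transpose M = M"
  shows "cnj (M $ j $ i) = M $ i $ j"
  using assms by (auto simp: conj_transpose_def vec_eq_iff)

text \<open>The library inner product on complex matrices is the real part of the Hilbert--Schmidt inner
  product; in trace form, multiplications can be moved across it.\<close>
lemma inner_eq_trace:
  fixes Y Z :: "complex ^ 'n ^ 'n"
  shows "inner Y Z = Re (trace (conj_transpose Y ** Z))"
proof -
  have "inner Y Z = (\<Sum>i\<in>UNIV. \<Sum>j\<in>UNIV. Re (cnj (Y $ i $ j) * Z $ i $ j))"
    by (simp add: inner_vec_def inner_complex_def)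
  also have "\<dots> = (\<Sum>j\<in>UNIV. \<Sum>i\<in>UNIV. Re (cnj (Y $ i $ j) * Z $ i $ j))"
    by (rule sum.swap)
  also have "\<dots> = Re (trace (conj_transpose Y ** Z))"
    by (simp add: trace_def conj_transpose_def matrix_matrix_mult_def)
  finally show ?thesis .
qed

lemma inner_mult_left_adjoint:
  fixes M Y Z :: "complex ^ 'n ^ 'n"
  shows "inner (M ** Y) Z = inner Y (conj_transpose M ** Z)"
  by (simp add: inner_eq_trace conj_transpose_mult matrix_mul_assoc)

lemma inner_mult_right_adjoint:
  fixes M Y Z :: "complex ^ 'n ^ 'n"
  shows "inner (Y ** M) Z = inner Y (Z ** conj_transpose M)"
proof -
  have "trace (conj_transpose M ** (conj_transpose Y ** Z))
      = trace ((conj_transpose Y ** Z) ** conj_transpose M)"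
    by (rule trace_mul_sym)
  then show ?thesis
    by (simp add: inner_eq_trace conj_transpose_mult matrix_mul_assoc)
qed


section \<open>Positive semidefinite matrices\<close>

definition positive_semidefinite :: "complex ^ 'n ^ 'n \<Rightarrow> bool" where
  "positive_semidefinite A \<longleftrightarrow>
     conj_transpose A = A \<and> (\<forall>x. 0 \<le> Re (hermitian_form A x))"

lemma positive_definite_imp_semidefinite:
  assumes "positive_definite A"
  shows "positive_semidefinite A"
  unfolding positive_semidefinite_def
proof (intro conjI allI)
  show "conj_transpose A = A"
    using assms by (simp add: positive_definite_def)
  show "0 \<le> Re (hermitian_form A x)" for x
    using assms by (cases "x = 0") (auto simp: positive_definite_def hermitian_form_def less_imp_le)
qed

lemma positive_semidefinite_congruence:
  fixes A Y :: "complex ^ 'n ^ 'n"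
  assumes "positive_semidefinite A"
  shows "positive_semidefinite (conj_transpose Y ** A ** Y)"
proof -
  have "hermitian_form (conj_transpose Y ** A ** Y) x = hermitian_form A (Y *v x)" for x
    by (simp add: hermitian_form_eq_hdot matrix_vector_mul_assoc [symmetric]
        hdot_conj_transpose_right)
  then show ?thesis
    using assms
    by (simp add: positive_semidefinite_def conj_transpose_mult conj_transpose_involution
        matrix_mul_assoc)
qed

lemma hermitian_form_add_cmult:
  assumes "conj_transpose B = B"
  shows "Re (hermitian_form B (x + c *s y))
       = Re (hermitian_form B x) + 2 * Re (c * hdot x (B *v y))
         + (cmod c)\<^sup>2 * Re (hermitian_form B y)"
proof -
  have sym: "hdot y (B *v x) = cnj (hdot x (B *v y))"
    by (metis assms cnj_hdot hdot_conj_transpose_right)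
  have "hermitian_form B (x + c *s y) = hermitian_form B x
      + (c * hdot x (B *v y) + cnj (c * hdot x (B *v y))) + (c * cnj c) * hermitian_form B y"
    by (simp add: hermitian_form_eq_hdot matrix_vector_right_distrib vector_scalar_commute
        hdot_add_left hdot_add_right hdot_cmult_left hdot_cmult_right sym algebra_simps)
  then show ?thesis
    by (simp add: complex_norm_square [symmetric] del: complex_cnj_mult of_real_power)
qed

lemma hermitian_form_axis: "hermitian_form B (axis k 1) = B $ k $ k"
  by (simp add: hermitian_form_eq_hdot hdot_axis_left matrix_vector_mult_axis)

text \<open>A semidefinite form that vanishes at a basis vector annihilates it: otherwise, perturbing some
  other basis vector in the direction of this one would change the form linearly, hence make it
  negative. Therefore a nonzero row can serve as a pivot row.\<close>
lemma positive_semidefinite_diagonal_pos: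
  assumes "positive_semidefinite B" and "B $ k \<noteq> 0"
  obtains d where "0 < d" and "B $ k $ k = of_real d"
proof
  have herm: "conj_transpose B = B" and pos: "\<And>x. 0 \<le> Re (hermitian_form B x)"
    using assms by (auto simp: positive_semidefinite_def)
  show real: "B $ k $ k = of_real (Re (B $ k $ k))"
    using hermitian_entry [OF herm, of k k] by (simp add: complex_eq_iff)
  have "0 \<le> Re (B $ k $ k)"
    using pos [of "axis k 1"] by (simp add: hermitian_form_axis)
  moreover have "Re (B $ k $ k) \<noteq> 0"
  proof
    assume zero: "Re (B $ k $ k) = 0"
    obtain j where j: "B $ k $ j \<noteq> 0"
      using assms(2) by (auto simp: vec_eq_iff)
    define w where "w = B $ j $ k"
    have w: "w \<noteq> 0"
      using j hermitian_entry [OF herm, of j k] by (auto simp: w_def)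
    \<comment> \<open>With the diagonal entry zero, the form at \<open>e\<^sub>j + s w\<^sup>* e\<^sub>k\<close> is affine in \<open>s\<close>;
      this \<open>s\<close> gives it the value \<open>-1\<close>.\<close>
    define s where "s = - (Re (B $ j $ j) + 1) / (2 * (cmod w)\<^sup>2)"
    have "hdot (axis j 1) (B *v axis k 1) = w"
      by (simp add: hdot_axis_left matrix_vector_mult_axis w_def)
    then have "of_real s * cnj w * hdot (axis j 1) (B *v axis k 1) = of_real (s * (cmod w)\<^sup>2)"
      by (metis complex_norm_square mult.assoc mult.commute of_real_mult)
    then have "Re (hermitian_form B (axis j 1 + (of_real s * cnj w) *s axis k 1))
        = Re (B $ j $ j) + 2 * (s * (cmod w)\<^sup>2)"
      unfolding hermitian_form_add_cmult [OF herm]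
      by (simp only: hermitian_form_axis Re_complex_of_real zero mult_zero_right add_0_right)
    also have "\<dots> = -1"
      using w by (simp add: s_def field_simps)
    finally show False
      using pos [of "axis j 1 + (of_real s * cnj w) *s axis k 1"] by simp
  qed
  ultimately show "0 < Re (B $ k $ k)" by simp
qed

text \<open>Unlike the usual Schur complement, this one keeps the eliminated row and column, filled with
  zeros, so that elimination does not change the dimension.\<close>
definition schur_complement :: "'n \<Rightarrow> complex ^ 'n ^ 'n \<Rightarrow> complex ^ 'n ^ 'n" where
  "schur_complement k B = (\<chi> i j. B $ i $ j - B $ i $ k * B $ k $ j / B $ k $ k)"

text \<open>The form of the Schur complement at \<open>x\<close> is the minimum of the form of \<open>B\<close> on the line through \<open>x\<close>
  in the direction of the pivot basis vector, hence it inherits nonnegativity.\<close>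
lemma positive_semidefinite_schur_complement:
  assumes B: "positive_semidefinite B" and nz: "B $ k \<noteq> 0"
  shows "positive_semidefinite (schur_complement k B)"
proof -
  obtain d where d: "0 < d" "B $ k $ k = of_real d"
    using positive_semidefinite_diagonal_pos [OF B nz] .
  have herm: "conj_transpose B = B" and pos: "\<And>x. 0 \<le> Re (hermitian_form B x)"
    using B by (auto simp: positive_semidefinite_def)
  have "conj_transpose (schur_complement k B) = schur_complement k B"
    by (simp add: conj_transpose_def schur_complement_def vec_eq_iff
        hermitian_entry [OF herm] mult.commute)
  moreover have "0 \<le> Re (hermitian_form (schur_complement k B) x)" for x
  proof -
    define u where "u = (B *v x) $ k"
    have left: "(\<Sum>i\<in>UNIV. cnj (x $ i) * B $ i $ k) = cnj u"
      by (simp add: u_def matrix_vector_mult_def hermitian_entry [OF herm] mult.commute)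
    have entry: "(schur_complement k B *v x) $ i = (B *v x) $ i - B $ i $ k * (u / d)" for i
      by (simp add: schur_complement_def matrix_vector_mult_def u_def d left_diff_distrib
          sum_subtractf sum_distrib_left sum_divide_distrib mult.assoc)
    have "hermitian_form (schur_complement k B) x
        = hermitian_form B x - (\<Sum>i\<in>UNIV. cnj (x $ i) * B $ i $ k) * (u / d)"
      by (simp add: hermitian_form_def entry right_diff_distrib sum_subtractf
          sum_distrib_right sum_divide_distrib mult.assoc)
    also have "\<dots> = hermitian_form B x - of_real ((cmod u)\<^sup>2 / d)"
      unfolding left of_real_divide complex_norm_square by (simp add: mult.commute)
    finally have schur: "Re (hermitian_form (schur_complement k B) x)
        = Re (hermitian_form B x) - (cmod u)\<^sup>2 / d" 
      by simp
    \<comment> \<open>The same value is attained by the form of \<open>B\<close> at the minimizer \<open>x - (u / d) e\<^sub>k\<close>.\<close>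
    have "hdot x (B *v axis k 1) = cnj u"
      using left by (simp add: hdot_def matrix_vector_mult_axis)
    then have "- (u / d) * hdot x (B *v axis k 1) = of_real (- ((cmod u)\<^sup>2 / d))"
      unfolding of_real_minus of_real_divide complex_norm_square by simp
    then have "Re (hermitian_form B (x + (- (u / d)) *s axis k 1))
        = Re (hermitian_form B x) + 2 * (- ((cmod u)\<^sup>2 / d)) + (cmod (u / d))\<^sup>2 * d"
      unfolding hermitian_form_add_cmult [OF herm]
      by (simp only: hermitian_form_axis Re_complex_of_real d norm_minus_cancel)
    also have "\<dots> = Re (hermitian_form B x) - (cmod u)\<^sup>2 / d"
      using d(1) by (simp add: norm_divide power_divide power2_eq_square)
    finally show ?thesis
      using pos schur by metis
  qed
  ultimately show ?thesis by (simp add: positive_semidefinite_def)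
qed

text \<open>The part of \<open>B\<close> removed by elimination has rank one, so its trace pairing with \<open>P\<close> is a value of
  the Hermitian form of \<open>P\<close>.\<close>
lemma trace_mult_schur_complement:
  fixes P B :: "complex ^ 'n ^ 'n"
  assumes "conj_transpose B = B"
  shows "trace (P ** B)
       = trace (P ** schur_complement k B) + hermitian_form P (column k B) / B $ k $ k"
proof -
  have "hermitian_form P (column k B) / B $ k $ k
      = (\<Sum>i\<in>UNIV. \<Sum>j\<in>UNIV. P $ i $ j * (B $ j $ k * B $ k $ i / B $ k $ k))"
    by (simp add: hermitian_form_def column_def matrix_vector_mult_def hermitian_entry [OF assms]
        sum_distrib_left sum_divide_distrib mult_ac)
  then show ?thesis
    by (simp add: trace_def matrix_matrix_mult_def schur_complement_def
        sum.distrib [symmetric] algebra_simps)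
qed

text \<open>Each elimination step changes the trace by a nonnegative amount and clears a nonzero row without
  creating new ones, so that the number of nonzero rows is a termination measure.\<close>
lemma trace_mult_positive_semidefinite_nonneg:
  fixes P B :: "complex ^ 'n ^ 'n"
  assumes "positive_semidefinite P" and "positive_semidefinite B"
  shows "0 \<le> Re (trace (P ** B))"
  using assms(2)
proof (induction "card {k. B $ k \<noteq> 0}" arbitrary: B rule: less_induct)
  case less
  show ?case
  proof (cases "B = 0")
    case True
    then show ?thesis by (simp add: trace_def matrix_matrix_mult_def)
  next
    case False
    then obtain k where k: "B $ k \<noteq> 0" by (auto simp: vec_eq_iff)
    obtain d where d: "0 < d" "B $ k $ k = of_real d"
      using positive_semidefinite_diagonal_pos [OF less.prems k] .
    have herm: "conj_transpose B = B"
      using less.prems by (simp add: positive_semidefinite_def)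
    let ?S = "schur_complement k B"
    have "?S $ k = 0"
      using d by (simp add: schur_complement_def vec_eq_iff)
    moreover have "?S $ i = 0" if "B $ i = 0" for i
      using that by (simp add: schur_complement_def vec_eq_iff)
    ultimately have "{i. ?S $ i \<noteq> 0} \<subset> {i. B $ i \<noteq> 0}"
      using k by blast
    then have "card {i. ?S $ i \<noteq> 0} < card {i. B $ i \<noteq> 0}"
      by (simp add: psubset_card_mono)
    then have "0 \<le> Re (trace (P ** ?S))"
      using less.hyps positive_semidefinite_schur_complement [OF less.prems k] by blast
    moreover have "0 \<le> Re (hermitian_form P (column k B) / B $ k $ k)"
      using assms(1) d by (simp add: positive_semidefinite_def)
    ultimately show ?thesis
      by (simp add: trace_mult_schur_complement [OF herm, of P k])
  qed
qed

text \<open>The inner product is the trace of \<open>Y\<^sup>* A Y\<close>, which is a congruence of \<open>A\<close>, times \<open>C\<close>.\<close>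
lemma inner_two_sided_mult_nonneg:
  fixes A C Y :: "complex ^ 'n ^ 'n"
  assumes "positive_semidefinite A" and "positive_semidefinite C"
  shows "0 \<le> inner (A ** Y ** C) Y"
proof -
  have "inner (A ** Y ** C) Y = inner Y (A ** Y ** C)"
    by (rule inner_commute)
  also have "\<dots> = Re (trace (conj_transpose Y ** A ** Y ** C))"
    by (simp add: inner_eq_trace matrix_mul_assoc)
  finally have "inner (A ** Y ** C) Y = Re (trace (conj_transpose Y ** A ** Y ** C))" .
  then show ?thesis
    using trace_mult_positive_semidefinite_nonneg
      [OF positive_semidefinite_congruence [OF assms(1)] assms(2)]
    by simp
qed


section \<open>Inverses and the norm inequality\<close>

lemma positive_definite_invertible:
  assumes "positive_definite A"
  shows "invertible A"
proof -
  have "x = 0" if "A *v x = 0" for x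
    using assms that by (force simp: positive_definite_def hermitian_form_eq_hdot hdot_def)
  then show ?thesis
    by (simp add: invertible_left_inverse matrix_left_invertible_ker)
qed

lemma positive_definite_mult_matrix_inv:
  assumes "positive_definite A"
  shows "A ** matrix_inv A = mat 1" and "matrix_inv A ** A = mat 1"
  using someI_ex [OF positive_definite_invertible [OF assms, unfolded invertible_def]]
  unfolding matrix_inv_def by blast+

lemma positive_semidefinite_matrix_inv:
  assumes "positive_definite A"
  shows "positive_semidefinite (matrix_inv A)"
proof -
  let ?I = "matrix_inv A"
  have herm: "conj_transpose A = A"
    using assms by (simp add: positive_definite_def)
  note inv = positive_definite_mult_matrix_inv [OF assms]
  have "conj_transpose ?I ** A = mat 1"
    using arg_cong [OF inv(1), of conj_transpose]
    by (simp add: conj_transpose_mult herm conj_transpose_mat_1)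
  then have hermI: "conj_transpose ?I = ?I"
    using inv by (metis matrix_mul_assoc matrix_mul_lid matrix_mul_rid)
  have "?I = conj_transpose ?I ** A ** ?I"
    by (simp add: hermI inv)
  then show ?thesis
    using positive_semidefinite_congruence [OF positive_definite_imp_semidefinite [OF assms]]
    by metis
qed

text \<open>With \<open>L\<close> the positive operator that sends \<open>Y\<close> to \<open>A Y B\<^sup>-\<^sup>1\<close>, the cross terms are the forms of \<open>L\<close>
  and of its inverse at \<open>X\<close>. Their sum exceeds \<open>2 \<parallel>X\<parallel>\<^sup>2\<close> by the form of \<open>L\<close> at \<open>X - L\<^sup>-\<^sup>1 X\<close>, the analogue
  of \<open>l + 1 / l - 2 = l (1 - 1 / l)\<^sup>2\<close> for a positive number \<open>l\<close>.\<close>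
lemma inner_cross_terms_ge:
  fixes A B X :: "complex ^ 'n ^ 'n"
  assumes A: "positive_definite A" and B: "positive_definite B"
  shows "2 * (norm X)\<^sup>2
       \<le> inner (A ** X) (X ** matrix_inv B) + inner (X ** B) (matrix_inv A ** X)"
proof -
  let ?A' = "matrix_inv A" and ?B' = "matrix_inv B"
  note invA = positive_definite_mult_matrix_inv [OF A] and invB = positive_definite_mult_matrix_inv [OF B]
  have herm: "conj_transpose A = A" "conj_transpose B = B" "conj_transpose ?B' = ?B'"
    using A B positive_semidefinite_matrix_inv [OF B]
    by (simp_all add: positive_definite_def positive_semidefinite_def)
  define Y where "Y = X - ?A' ** X ** B"
  have "A ** (?A' ** X ** B) ** ?B' = (A ** ?A') ** X ** (B ** ?B')"
    by (simp add: matrix_mul_assoc)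
  then have AYB: "A ** Y ** ?B' = A ** X ** ?B' - X"
    by (simp add: Y_def matrix_mult_diff_distrib_left matrix_mult_diff_distrib_right invA invB)
  have "inner (A ** X ** ?B') (?A' ** X ** B) = inner X (A ** (?A' ** X ** B ** ?B'))"
    by (simp only: inner_mult_right_adjoint [of "A ** X"] inner_mult_left_adjoint [of A X] herm)
  also have "A ** (?A' ** X ** B ** ?B') = (A ** ?A') ** X ** (B ** ?B')"
    by (simp add: matrix_mul_assoc)
  finally have corner: "inner (A ** X ** ?B') (?A' ** X ** B) = (norm X)\<^sup>2"
    by (simp add: invA invB power2_norm_eq_inner)
  have "0 \<le> inner (A ** Y ** ?B') Y"
    by (intro inner_two_sided_mult_nonneg positive_definite_imp_semidefinite A
        positive_semidefinite_matrix_inv B)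
  also have "\<dots> = inner (A ** X ** ?B') X + inner X (?A' ** X ** B) - 2 * (norm X)\<^sup>2"
    unfolding AYB by (simp add: Y_def inner_diff_left inner_diff_right corner power2_norm_eq_inner)
  also have "inner (A ** X ** ?B') X = inner (A ** X) (X ** ?B')"
    by (simp add: inner_mult_right_adjoint herm)
  also have "inner X (?A' ** X ** B) = inner (X ** B) (?A' ** X)"
    by (simp add: inner_mult_right_adjoint herm)
  finally show ?thesis by simp
qed

text \<open>Here \<open>(1 - t)\<^sup>2 + t\<^sup>2 + 2 (1 - t) t = 1\<close> collects the two equal diagonal terms and the lower bound
  for the cross terms. The range of \<open>t\<close> makes the weight of the cross terms nonnegative.\<close>
lemma inner_weighted_means_ge:
  fixes A B X :: "complex ^ 'n ^ 'n" and t :: real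
  assumes A: "positive_definite A" and B: "positive_definite B" and t: "0 \<le> t" "t \<le> 1"
  shows "(norm X)\<^sup>2 \<le> inner ((1 - t) *\<^sub>R (A ** X) + t *\<^sub>R (X ** B))
           ((1 - t) *\<^sub>R (matrix_inv A ** X) + t *\<^sub>R (X ** matrix_inv B))"
proof -
  let ?A' = "matrix_inv A" and ?B' = "matrix_inv B"
  have herm: "conj_transpose A = A" "conj_transpose B = B"
    using A B by (simp_all add: positive_definite_def)
  have left: "inner (A ** X) (?A' ** X) = (norm X)\<^sup>2"
    by (simp add: inner_mult_left_adjoint herm matrix_mul_assoc
        positive_definite_mult_matrix_inv [OF A] power2_norm_eq_inner)
  have right: "inner (X ** B) (X ** ?B') = (norm X)\<^sup>2"
    by (simp add: inner_mult_right_adjoint herm matrix_mul_assoc [symmetric]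
        positive_definite_mult_matrix_inv [OF B] power2_norm_eq_inner)
  have "(norm X)\<^sup>2 = ((1 - t)\<^sup>2 + t\<^sup>2) * (norm X)\<^sup>2 + (1 - t) * t * (2 * (norm X)\<^sup>2)"
    by (simp add: power2_eq_square algebra_simps)
  also have "\<dots> \<le> ((1 - t)\<^sup>2 + t\<^sup>2) * (norm X)\<^sup>2
      + (1 - t) * t * (inner (A ** X) (X ** ?B') + inner (X ** B) (?A' ** X))"
    using t by (intro add_left_mono mult_left_mono inner_cross_terms_ge A B) auto
  also have "\<dots> = inner ((1 - t) *\<^sub>R (A ** X) + t *\<^sub>R (X ** B))
      ((1 - t) *\<^sub>R (?A' ** X) + t *\<^sub>R (X ** ?B'))"
    by (simp add: inner_add_left inner_add_right left right power2_eq_square algebra_simps)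
  finally show ?thesis .
qed

theorem theorem3p12:
  fixes A B X :: "complex ^ 'n ^ 'n" and t :: real
  assumes "positive_definite A" and "positive_definite B"
    and "0 \<le> t" and "t \<le> 1"
    and "(1 - t) *\<^sub>R (matrix_inv A ** X) + t *\<^sub>R (X ** matrix_inv B) \<noteq> 0"
    and "(1 - t) *\<^sub>R (A ** X) + t *\<^sub>R (X ** B) \<noteq> 0"
  shows "(hs_norm X)\<^sup>2
           * inverse (hs_norm ((1 - t) *\<^sub>R (matrix_inv A ** X) + t *\<^sub>R (X ** matrix_inv B)))
         \<le> hs_norm ((1 - t) *\<^sub>R (A ** X) + t *\<^sub>R (X ** B))"
proof -
  let ?N = "(1 - t) *\<^sub>R (matrix_inv A ** X) + t *\<^sub>R (X ** matrix_inv B)"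
  let ?M = "(1 - t) *\<^sub>R (A ** X) + t *\<^sub>R (X ** B)"
  have pos: "0 < norm ?N"
    using assms(5) unfolding zero_less_norm_iff .
  have "(norm X)\<^sup>2 \<le> inner ?M ?N"
    using assms(1-4) by (rule inner_weighted_means_ge)
  also have "\<dots> \<le> norm ?M * norm ?N"
    by (rule norm_cauchy_schwarz)
  finally have "(norm X)\<^sup>2 / norm ?N \<le> norm ?M"
    using pos by (simp only: pos_divide_le_eq)
  then show ?thesis
    by (simp only: hs_norm_eq_norm divide_inverse)
qed

end
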